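(* Let $\alpha=(\alpha_\top,\alpha_\perp)\colon f_A\to f_B$ be a double extension of racks (or quandles), with $f_A\colon A_\top\to A_\perp$. The following conditions, each required for all $x\in A_\top$ and all $(a,b,c,d)\in\mathrm{Eq}(f_A)\,\square\,\mathrm{Eq}(\alpha_\top)$, are equivalent: (i) $x\triangleleft a\triangleleft^{-1}b\triangleleft c\triangleleft^{-1}d=x$; (ii) $x\triangleleft^{-1}a\triangleleft d\triangleleft^{-1}c\triangleleft b=x$; (iii) $x\triangleleft^{-1}a\triangleleft b\triangleleft^{-1}c\triangleleft d=x$; (iv) $x\triangleleft a\triangleleft^{-1}d\triangleleft c\triangleleft^{-1}b=x$. Moreover, $\alpha$ is a double covering (i.e. these equivalent conditions hold) if and only if $[\mathrm{Eq}(f_A),\mathrm{Eq}(\alpha_\top)]=\Delta_{A_\top}$, the diagonal relation on $A_\top$.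
   Context: A rack is a set $A$ with binary operations $\triangleleft,\triangleleft^{-1}$ such that $(x\triangleleft a)\triangleleft^{-1}a=x=(x\triangleleft^{-1}a)\triangleleft a$ and $(x\triangleleft a)\triangleleft b=(x\triangleleft b)\triangleleft(a\triangleleft b)$ for all $x,a,b\in A$. A quandle is a rack with $a\triangleleft a=a$ for all $a$. Morphisms are functions preserving $\triangleleft$. Unbracketed expressions are evaluated from left to right. $\mathrm{Eq}(f)=\{(a,b)\mid f(a)=f(b)\}$. An extension is a surjective morphism. A morphism of extensions $\alpha=(\alpha_\top,\alpha_\perp)\colon f_A\to f_B$, for extensions $f_A\colon A_\top\to A_\perp$ and $f_B\colon B_\top\to B_\perp$, is a pair of morphisms $\alpha_\top\colon A_\top\to B_\top$, $\alpha_\perp\colon A_\perp\to B_\perp$ with $f_B\alpha_\top=\alpha_\perp f_A$. It is a double extension if $\alpha_\top$, $\alpha_\perp$ and the comparison map $A_\top\to A_\perp\times_{B_\perp}B_\top$ are surjective. For congruences $R,S$ on a rack $A$, $R\,\square\,S$ is the set of $(a,b,c,d)\in A^4$ with $(a,b),(d,c)\in R$ and $(a,d),(b,c)\in S$, and $[R,S]$ is the congruence on $A$ generated by the pairs $(x\triangleleft a\triangleleft^{-1}b\triangleleft c\triangleleft^{-1}d,\ x)$ with $x\in A$, $(a,b,c,d)\in R\,\square\,S$. *)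

theory Defs
  imports "HOL-Algebra.Congruence"
begin

record 'a rack = "'a partial_object" +
  act :: "['a, 'a] \<Rightarrow> 'a" (infixl "\<triangleleft>\<index>" 70)
  act_inv :: "['a, 'a] \<Rightarrow> 'a" (infixl "\<triangleleft>\<^sup>-\<^sup>1\<index>" 70)

locale rack =
  fixes A (structure)
  assumes act_closed: "\<lbrakk>x \<in> carrier A; a \<in> carrier A\<rbrakk> \<Longrightarrow> x \<triangleleft> a \<in> carrier A"
    and act_inv_closed: "\<lbrakk>x \<in> carrier A; a \<in> carrier A\<rbrakk> \<Longrightarrow> x \<triangleleft>\<^sup>-\<^sup>1 a \<in> carrier A"
    and act_act_inv: "\<lbrakk>x \<in> carrier A; a \<in> carrier A\<rbrakk> \<Longrightarrow> (x \<triangleleft> a) \<triangleleft>\<^sup>-\<^sup>1 a = x"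
    and act_inv_act: "\<lbrakk>x \<in> carrier A; a \<in> carrier A\<rbrakk> \<Longrightarrow> (x \<triangleleft>\<^sup>-\<^sup>1 a) \<triangleleft> a = x"
    and self_distrib: "\<lbrakk>x \<in> carrier A; a \<in> carrier A; b \<in> carrier A\<rbrakk>
      \<Longrightarrow> (x \<triangleleft> a) \<triangleleft> b = (x \<triangleleft> b) \<triangleleft> (a \<triangleleft> b)"

locale quandle = rack +
  assumes idem: "a \<in> carrier A \<Longrightarrow> a \<triangleleft> a = a"

definition rack_hom :: "('a, 'm) rack_scheme \<Rightarrow> ('b, 'n) rack_scheme \<Rightarrow> ('a \<Rightarrow> 'b) set" where
  "rack_hom A B = {f. (\<forall>x\<in>carrier A. f x \<in> carrier B) \<and>
     (\<forall>x\<in>carrier A. \<forall>y\<in>carrier A. f (x \<triangleleft>\<^bsub>A\<^esub> y) = f x \<triangleleft>\<^bsub>B\<^esub> f y)}"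

definition kernel_pair :: "('a, 'm) rack_scheme \<Rightarrow> ('a \<Rightarrow> 'b) \<Rightarrow> ('a \<times> 'a) set" where
  "kernel_pair A f = {(a, b). a \<in> carrier A \<and> b \<in> carrier A \<and> f a = f b}"

locale rack_extension = A: rack A + B: rack B for A (structure) and B (structure) +
  fixes f
  assumes hom: "f \<in> rack_hom A B"
    and surj: "f ` carrier A = carrier B"

text \<open>The objects are ordered as top and bottom of the domain extension, then top and bottom
  of the codomain extension; the maps as in \<open>fB \<circ> \<alpha>t = \<alpha>b \<circ> fA\<close>.\<close>

locale extension_morphism =
  fA: rack_extension At Ab fA + fB: rack_extension Bt Bb fB
  for At (structure) and Ab (structure) and Bt (structure) and Bb (structure) and fA and fB +
  fixes \<alpha>t and \<alpha>b
  assumes top_hom: "\<alpha>t \<in> rack_hom At Bt"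
    and bottom_hom: "\<alpha>b \<in> rack_hom Ab Bb"
    and commutes: "x \<in> carrier At \<Longrightarrow> fB (\<alpha>t x) = \<alpha>b (fA x)"

locale double_extension = extension_morphism +
  assumes top_surj: "\<alpha>t ` carrier At = carrier Bt"
    and bottom_surj: "\<alpha>b ` carrier Ab = carrier Bb"
    and comparison_surj: "(\<lambda>x. (fA x, \<alpha>t x)) ` carrier At
      = {(y, z). y \<in> carrier Ab \<and> z \<in> carrier Bt \<and> \<alpha>b y = fB z}"

locale quandle_double_extension = double_extension +
  assumes quandles: "quandle At" "quandle Ab" "quandle Bt" "quandle Bb"

definition square :: "('a \<times> 'a) set \<Rightarrow> ('a \<times> 'a) set \<Rightarrow> ('a \<times> 'a \<times> 'a \<times> 'a) set" (infixl "\<box>" 65) where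
  "R \<box> S = {(a, b, c, d). (a, b) \<in> R \<and> (d, c) \<in> R \<and> (a, d) \<in> S \<and> (b, c) \<in> S}"

text \<open>Compatibility with the inverse operation does not follow from compatibility with
  \<open>\<triangleleft>\<close> when the carrier is infinite.\<close>

definition rack_congruence :: "('a, 'm) rack_scheme \<Rightarrow> ('a \<times> 'a) set \<Rightarrow> bool" where
  "rack_congruence A R \<longleftrightarrow> equiv (carrier A) R \<and>
     (\<forall>(x, y)\<in>R. \<forall>(a, b)\<in>R. (x \<triangleleft>\<^bsub>A\<^esub> a, y \<triangleleft>\<^bsub>A\<^esub> b) \<in> R \<and>
       (x \<triangleleft>\<^sup>-\<^sup>1\<^bsub>A\<^esub> a, y \<triangleleft>\<^sup>-\<^sup>1\<^bsub>A\<^esub> b) \<in> R)"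

definition congruence_generated :: "('a, 'm) rack_scheme \<Rightarrow> ('a \<times> 'a) set \<Rightarrow> ('a \<times> 'a) set" where
  "congruence_generated A P = \<Inter>{R. rack_congruence A R \<and> P \<subseteq> R}"

definition commutator ::
  "('a, 'm) rack_scheme \<Rightarrow> ('a \<times> 'a) set \<Rightarrow> ('a \<times> 'a) set \<Rightarrow> ('a \<times> 'a) set" where
  "commutator A R S = congruence_generated A
     {(x \<triangleleft>\<^bsub>A\<^esub> a \<triangleleft>\<^sup>-\<^sup>1\<^bsub>A\<^esub> b \<triangleleft>\<^bsub>A\<^esub> c \<triangleleft>\<^sup>-\<^sup>1\<^bsub>A\<^esub> d, x) | x a b c d.
       x \<in> carrier A \<and> (a, b, c, d) \<in> R \<box> S}"

definition double_covering where
  "double_covering At Ab Bt Bb fA fB \<alpha>t \<alpha>b \<longleftrightarrow>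
     double_extension At Ab Bt Bb fA fB \<alpha>t \<alpha>b \<and>
     (\<forall>x\<in>carrier At. \<forall>(a, b, c, d)\<in>kernel_pair At fA \<box> kernel_pair At \<alpha>t.
       x \<triangleleft>\<^bsub>At\<^esub> a \<triangleleft>\<^sup>-\<^sup>1\<^bsub>At\<^esub> b \<triangleleft>\<^bsub>At\<^esub> c \<triangleleft>\<^sup>-\<^sup>1\<^bsub>At\<^esub> d = x)"

end

theory Submission
  imports Defs
begin

text \<open>Write \<open>\<rho>\<^sub>a\<close> for the permutation \<open>x \<mapsto> x \<triangleleft> a\<close> of the carrier and compose from left to right.
  Condition (i) says \<open>\<rho>\<^sub>a \<rho>\<^sub>b\<^sup>-\<^sup>1 \<rho>\<^sub>c \<rho>\<^sub>d\<^sup>-\<^sup>1 = 1\<close>, that is, \<open>\<rho>\<^sub>a \<rho>\<^sub>b\<^sup>-\<^sup>1 = \<rho>\<^sub>d \<rho>\<^sub>c\<^sup>-\<^sup>1\<close>, and (ii) is this same equation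
  solved differently, for each square separately. Reflecting a square in the diagonal through
  \<open>a\<close> and \<open>c\<close> exchanges \<open>b\<close> with \<open>d\<close> and the two congruences with each other; it turns (i) into (iv)
  and (ii) into (iii). So everything reduces to one claim: (i) is symmetric in the two congruences.

  This claim is not true square by square. The reason for it is that \<open>R \<box> S\<close> is a subrack of the
  fourth power of the carrier, and that self-distributivity makes
  \<open>\<rho>\<close> turn the inverse action into conjugation: the permutation of \<open>a \<triangleleft>\<^sup>-\<^sup>1 b\<close> is \<open>\<rho>\<^sub>b \<rho>\<^sub>a \<rho>\<^sub>b\<^sup>-\<^sup>1\<close>
  (lemmas \<open>act_by_act_inv\<close> and \<open>act_inv_by_act_inv\<close>). Letting the degenerate square
  \<open>(a, b, b, a)\<close> act inversely on \<open>(a, b, c, d)\<close> therefore gives a square whose permutations are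
  \<open>\<rho>\<^sub>a\<close>, \<open>\<rho>\<^sub>b\<close>, \<open>\<rho>\<^sub>b \<rho>\<^sub>c \<rho>\<^sub>b\<^sup>-\<^sup>1\<close>, \<open>\<rho>\<^sub>a \<rho>\<^sub>d \<rho>\<^sub>a\<^sup>-\<^sup>1\<close>, and condition (i) for it reads, after cancellation,
  \<open>\<rho>\<^sub>c \<rho>\<^sub>b\<^sup>-\<^sup>1 \<rho>\<^sub>a \<rho>\<^sub>d\<^sup>-\<^sup>1 = 1\<close>, which is condition (i) for \<open>(c, b, a, d)\<close>, the reflection in
  the other diagonal, an element of \<open>S \<box> R\<close> (lemma \<open>squares_act_trivially_commute\<close>).

  The argument applies to the two kernel pairs because they are congruences: a map preserving
  \<open>\<triangleleft>\<close> preserves its inverse as well. The last equivalence holds because the diagonal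
  is the least congruence.\<close>

definition squares_act_trivially ::
  "('a, 'm) rack_scheme \<Rightarrow> ('a \<times> 'a) set \<Rightarrow> ('a \<times> 'a) set \<Rightarrow> bool" where
  "squares_act_trivially A R S \<longleftrightarrow> (\<forall>x\<in>carrier A. \<forall>(a, b, c, d)\<in>R \<box> S.
     x \<triangleleft>\<^bsub>A\<^esub> a \<triangleleft>\<^sup>-\<^sup>1\<^bsub>A\<^esub> b \<triangleleft>\<^bsub>A\<^esub> c \<triangleleft>\<^sup>-\<^sup>1\<^bsub>A\<^esub> d = x)"

lemma square_transpose: "(a, d, c, b) \<in> S \<box> R \<longleftrightarrow> (a, b, c, d) \<in> R \<box> S"
  by (auto simp: square_def)

lemma rack_congruence_sym: "rack_congruence A R \<Longrightarrow> (x, y) \<in> R \<Longrightarrow> (y, x) \<in> R"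
  by (auto simp: rack_congruence_def equiv_def dest: symD)

lemma rack_congruence_carrier:
  "rack_congruence A R \<Longrightarrow> (x, y) \<in> R \<Longrightarrow> x \<in> carrier A \<and> y \<in> carrier A"
  by (auto simp: rack_congruence_def equiv_def)

lemma rack_congruence_refl: "rack_congruence A R \<Longrightarrow> x \<in> carrier A \<Longrightarrow> (x, x) \<in> R"
  by (auto simp: rack_congruence_def equiv_def dest: refl_onD)

lemma rack_congruence_act_inv:
  "rack_congruence A R \<Longrightarrow> (x, y) \<in> R \<Longrightarrow> (a, b) \<in> R
    \<Longrightarrow> (x \<triangleleft>\<^sup>-\<^sup>1\<^bsub>A\<^esub> a, y \<triangleleft>\<^sup>-\<^sup>1\<^bsub>A\<^esub> b) \<in> R"
  by (fastforce simp: rack_congruence_def)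

lemma square_carrier:
  assumes "rack_congruence A R" "(a, b, c, d) \<in> R \<box> S"
  shows "a \<in> carrier A" "b \<in> carrier A" "c \<in> carrier A" "d \<in> carrier A"
  using assms rack_congruence_carrier[OF assms(1)] by (auto simp: square_def)

context rack
begin

lemma rack_congruence_Id_on: "rack_congruence A (Id_on (carrier A))"
  by (auto simp: rack_congruence_def act_closed act_inv_closed
      intro!: equivI refl_onI symI transI)

lemma act_by_act_inv:
  assumes "x \<in> carrier A" "a \<in> carrier A" "b \<in> carrier A"
  shows "x \<triangleleft> (a \<triangleleft>\<^sup>-\<^sup>1 b) = x \<triangleleft> b \<triangleleft> a \<triangleleft>\<^sup>-\<^sup>1 b"
proof -
  have "x \<triangleleft> (a \<triangleleft>\<^sup>-\<^sup>1 b) \<triangleleft> b = x \<triangleleft> b \<triangleleft> a"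
    using self_distrib[of x "a \<triangleleft>\<^sup>-\<^sup>1 b" b] assms by (simp add: act_inv_closed act_inv_act)
  then show ?thesis
    using act_act_inv[of "x \<triangleleft> (a \<triangleleft>\<^sup>-\<^sup>1 b)" b] assms by (simp add: act_closed act_inv_closed)
qed

lemma act_inv_by_act_inv:
  assumes "x \<in> carrier A" "a \<in> carrier A" "b \<in> carrier A"
  shows "x \<triangleleft>\<^sup>-\<^sup>1 (a \<triangleleft>\<^sup>-\<^sup>1 b) = x \<triangleleft> b \<triangleleft>\<^sup>-\<^sup>1 a \<triangleleft>\<^sup>-\<^sup>1 b"
proof -
  let ?y = "x \<triangleleft> b \<triangleleft>\<^sup>-\<^sup>1 a \<triangleleft>\<^sup>-\<^sup>1 b"
  have "?y \<triangleleft> (a \<triangleleft>\<^sup>-\<^sup>1 b) = x"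
    using assms by (simp add: act_by_act_inv act_closed act_inv_closed act_act_inv act_inv_act)
  then show ?thesis
    using act_act_inv[of ?y "a \<triangleleft>\<^sup>-\<^sup>1 b"] assms by (simp add: act_closed act_inv_closed)
qed

text \<open>Stated for a fixed quadruple but for all \<open>x\<close>, since passing from one side to the other
  replaces \<open>x\<close> by its translate under the permutation
  of \<open>a\<close> or its inverse.\<close>

lemma alternating_word_trivial_iff:
  assumes [simp]: "a \<in> carrier A" "b \<in> carrier A" "c \<in> carrier A" "d \<in> carrier A"
  shows "(\<forall>x\<in>carrier A. x \<triangleleft> a \<triangleleft>\<^sup>-\<^sup>1 b \<triangleleft> c \<triangleleft>\<^sup>-\<^sup>1 d = x)
    \<longleftrightarrow> (\<forall>x\<in>carrier A. x \<triangleleft>\<^sup>-\<^sup>1 a \<triangleleft> d \<triangleleft>\<^sup>-\<^sup>1 c \<triangleleft> b = x)" (is "?L \<longleftrightarrow> ?R")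
proof
  assume L: ?L
  show ?R
  proof
    fix x assume [simp]: "x \<in> carrier A"
    have "x \<triangleleft>\<^sup>-\<^sup>1 a = x \<triangleleft>\<^sup>-\<^sup>1 b \<triangleleft> c \<triangleleft>\<^sup>-\<^sup>1 d"
      using bspec[OF L, of "x \<triangleleft>\<^sup>-\<^sup>1 a"] by (simp add: act_inv_closed act_inv_act)
    then show "x \<triangleleft>\<^sup>-\<^sup>1 a \<triangleleft> d \<triangleleft>\<^sup>-\<^sup>1 c \<triangleleft> b = x"
      by (simp add: act_closed act_inv_closed act_act_inv act_inv_act)
  qed
next
  assume R: ?R
  show ?L
  proof
    fix x assume [simp]: "x \<in> carrier A"
    have "x \<triangleleft> a = x \<triangleleft> d \<triangleleft>\<^sup>-\<^sup>1 c \<triangleleft> b"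
      using bspec[OF R, of "x \<triangleleft> a"] by (simp add: act_closed act_act_inv)
    then show "x \<triangleleft> a \<triangleleft>\<^sup>-\<^sup>1 b \<triangleleft> c \<triangleleft>\<^sup>-\<^sup>1 d = x"
      by (simp add: act_closed act_inv_closed act_act_inv act_inv_act)
  qed
qed

lemma squares_act_trivially_iff:
  assumes "rack_congruence A R"
  shows "squares_act_trivially A R S \<longleftrightarrow> (\<forall>x\<in>carrier A. \<forall>(a, b, c, d)\<in>R \<box> S.
    x \<triangleleft>\<^sup>-\<^sup>1 a \<triangleleft> d \<triangleleft>\<^sup>-\<^sup>1 c \<triangleleft> b = x)"
proof -
  have "squares_act_trivially A R S \<longleftrightarrow> (\<forall>a b c d. (a, b, c, d) \<in> R \<box> S
      \<longrightarrow> (\<forall>x\<in>carrier A. x \<triangleleft> a \<triangleleft>\<^sup>-\<^sup>1 b \<triangleleft> c \<triangleleft>\<^sup>-\<^sup>1 d = x))"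
    unfolding squares_act_trivially_def by blast
  also have "\<dots> \<longleftrightarrow> (\<forall>a b c d. (a, b, c, d) \<in> R \<box> S
      \<longrightarrow> (\<forall>x\<in>carrier A. x \<triangleleft>\<^sup>-\<^sup>1 a \<triangleleft> d \<triangleleft>\<^sup>-\<^sup>1 c \<triangleleft> b = x))"
    using square_carrier[OF assms]
    by (intro all_cong1 imp_cong[OF refl] alternating_word_trivial_iff)
  also have "\<dots> \<longleftrightarrow> (\<forall>x\<in>carrier A. \<forall>(a, b, c, d)\<in>R \<box> S. x \<triangleleft>\<^sup>-\<^sup>1 a \<triangleleft> d \<triangleleft>\<^sup>-\<^sup>1 c \<triangleleft> b = x)"
    by blast
  finally show ?thesis .
qed

text \<open>Acting by a degenerate square conjugates the translations at two adjacent corners; the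
  conjugating factors cancel against their neighbours in the word and so reorder it.\<close>

lemma squares_act_trivially_swap:
  assumes R: "rack_congruence A R" and S: "rack_congruence A S"
    and triv: "squares_act_trivially A R S"
  shows "squares_act_trivially A S R"
proof -
  have "x \<triangleleft> a \<triangleleft>\<^sup>-\<^sup>1 b \<triangleleft> c \<triangleleft>\<^sup>-\<^sup>1 d = x"
    if x: "x \<in> carrier A" and sq: "(a, b, c, d) \<in> S \<box> R" for x a b c d
  proof -
    note [simp] = square_carrier[OF S sq] x
    \<comment> \<open>The square \<open>(c, b, a, d) \<in> R \<box> S\<close>, acted on inversely by \<open>(c, b, b, c)\<close>.\<close>
    have "(c \<triangleleft>\<^sup>-\<^sup>1 c, b \<triangleleft>\<^sup>-\<^sup>1 b, a \<triangleleft>\<^sup>-\<^sup>1 b, d \<triangleleft>\<^sup>-\<^sup>1 c) \<in> R \<box> S"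
      using sq unfolding square_def
      by (auto intro!: rack_congruence_act_inv R S rack_congruence_refl
          intro: rack_congruence_sym[OF R] rack_congruence_sym[OF S])
    \<comment> \<open>The word of this square is the wanted word conjugated by the translation by \<open>c\<close>;
      evaluating at \<open>x \<triangleleft>\<^sup>-\<^sup>1 c\<close> undoes the conjugation.\<close>
    then have "x \<triangleleft>\<^sup>-\<^sup>1 c \<triangleleft> (c \<triangleleft>\<^sup>-\<^sup>1 c) \<triangleleft>\<^sup>-\<^sup>1 (b \<triangleleft>\<^sup>-\<^sup>1 b) \<triangleleft> (a \<triangleleft>\<^sup>-\<^sup>1 b) \<triangleleft>\<^sup>-\<^sup>1 (d \<triangleleft>\<^sup>-\<^sup>1 c)
        = x \<triangleleft>\<^sup>-\<^sup>1 c"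
      using triv unfolding squares_act_trivially_def by (fastforce simp: act_inv_closed)
    then have "x \<triangleleft> a \<triangleleft>\<^sup>-\<^sup>1 b \<triangleleft> c \<triangleleft>\<^sup>-\<^sup>1 d \<triangleleft>\<^sup>-\<^sup>1 c = x \<triangleleft>\<^sup>-\<^sup>1 c"
      by (simp add: act_by_act_inv act_inv_by_act_inv act_closed act_inv_closed
          act_act_inv act_inv_act)
    then have "x \<triangleleft> a \<triangleleft>\<^sup>-\<^sup>1 b \<triangleleft> c \<triangleleft>\<^sup>-\<^sup>1 d \<triangleleft>\<^sup>-\<^sup>1 c \<triangleleft> c = x \<triangleleft>\<^sup>-\<^sup>1 c \<triangleleft> c"
      by simp
    then show ?thesis
      by (simp add: act_closed act_inv_closed act_inv_act)
  qed
  then show ?thesis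
    unfolding squares_act_trivially_def by blast
qed

lemma squares_act_trivially_commute:
  assumes "rack_congruence A R" "rack_congruence A S"
  shows "squares_act_trivially A R S \<longleftrightarrow> squares_act_trivially A S R"
  using squares_act_trivially_swap assms by blast

lemma congruence_generated_eq_diagonal_iff:
  "congruence_generated A P = Id_on (carrier A) \<longleftrightarrow> P \<subseteq> Id_on (carrier A)"
proof
  assume "congruence_generated A P = Id_on (carrier A)"
  then show "P \<subseteq> Id_on (carrier A)"
    unfolding congruence_generated_def by blast
next
  assume "P \<subseteq> Id_on (carrier A)"
  then have "congruence_generated A P \<subseteq> Id_on (carrier A)"
    unfolding congruence_generated_def using rack_congruence_Id_on by blast
  moreover have "Id_on (carrier A) \<subseteq> congruence_generated A P"
    unfolding congruence_generated_def by (auto intro: rack_congruence_refl)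
  ultimately show "congruence_generated A P = Id_on (carrier A)" ..
qed

lemma commutator_eq_diagonal_iff:
  "commutator A R S = Id_on (carrier A) \<longleftrightarrow> squares_act_trivially A R S"
  unfolding commutator_def squares_act_trivially_def congruence_generated_eq_diagonal_iff
  by (auto simp: Id_on_iff) fastforce+

lemma rack_hom_act_inv:
  assumes "rack B" "f \<in> rack_hom A B" "x \<in> carrier A" "a \<in> carrier A"
  shows "f (x \<triangleleft>\<^sup>-\<^sup>1 a) = f x \<triangleleft>\<^sup>-\<^sup>1\<^bsub>B\<^esub> f a"
proof -
  interpret B: rack B by fact
  have cl: "f y \<in> carrier B" if "y \<in> carrier A" for y
    using assms(2) that by (simp add: rack_hom_def)
  have "f (x \<triangleleft>\<^sup>-\<^sup>1 a) \<triangleleft>\<^bsub>B\<^esub> f a = f (x \<triangleleft>\<^sup>-\<^sup>1 a \<triangleleft> a)"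
    using assms by (simp add: rack_hom_def act_inv_closed)
  also have "\<dots> = f x"
    using assms by (simp add: act_inv_act)
  finally show ?thesis
    using B.act_act_inv[of "f (x \<triangleleft>\<^sup>-\<^sup>1 a)" "f a"] assms by (simp add: cl act_inv_closed)
qed

lemma rack_congruence_kernel_pair:
  assumes "rack B" "f \<in> rack_hom A B"
  shows "rack_congruence A (kernel_pair A f)"
proof -
  have "f (x \<triangleleft> a) = f x \<triangleleft>\<^bsub>B\<^esub> f a" if "x \<in> carrier A" "a \<in> carrier A" for x a
    using assms(2) that by (simp add: rack_hom_def)
  moreover have "equiv (carrier A) (kernel_pair A f)"
    by (auto simp: kernel_pair_def intro!: equivI refl_onI symI transI)
  ultimately show ?thesis
    by (auto simp: rack_congruence_def kernel_pair_def act_closed act_inv_closed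
        rack_hom_act_inv[OF assms])
qed

end

theorem corollary3p1p5:
  fixes At :: "('a, 'm) rack_scheme" (structure)
    and Ab :: "('b, 'n) rack_scheme"
    and Bt :: "('c, 'p) rack_scheme"
    and Bb :: "('d, 'q) rack_scheme"
    and fA :: "'a \<Rightarrow> 'b" and fB :: "'c \<Rightarrow> 'd"
    and \<alpha>t :: "'a \<Rightarrow> 'c" and \<alpha>b :: "'b \<Rightarrow> 'd"
  assumes "double_extension At Ab Bt Bb fA fB \<alpha>t \<alpha>b
    \<or> quandle_double_extension At Ab Bt Bb fA fB \<alpha>t \<alpha>b"
  shows "((\<forall>x\<in>carrier At. \<forall>(a, b, c, d)\<in>kernel_pair At fA \<box> kernel_pair At \<alpha>t.
            x \<triangleleft> a \<triangleleft>\<^sup>-\<^sup>1 b \<triangleleft> c \<triangleleft>\<^sup>-\<^sup>1 d = x)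
          \<longleftrightarrow> (\<forall>x\<in>carrier At. \<forall>(a, b, c, d)\<in>kernel_pair At fA \<box> kernel_pair At \<alpha>t.
            x \<triangleleft>\<^sup>-\<^sup>1 a \<triangleleft> d \<triangleleft>\<^sup>-\<^sup>1 c \<triangleleft> b = x))
       \<and> ((\<forall>x\<in>carrier At. \<forall>(a, b, c, d)\<in>kernel_pair At fA \<box> kernel_pair At \<alpha>t.
            x \<triangleleft> a \<triangleleft>\<^sup>-\<^sup>1 b \<triangleleft> c \<triangleleft>\<^sup>-\<^sup>1 d = x)
          \<longleftrightarrow> (\<forall>x\<in>carrier At. \<forall>(a, b, c, d)\<in>kernel_pair At fA \<box> kernel_pair At \<alpha>t.
            x \<triangleleft>\<^sup>-\<^sup>1 a \<triangleleft> b \<triangleleft>\<^sup>-\<^sup>1 c \<triangleleft> d = x))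
       \<and> ((\<forall>x\<in>carrier At. \<forall>(a, b, c, d)\<in>kernel_pair At fA \<box> kernel_pair At \<alpha>t.
            x \<triangleleft> a \<triangleleft>\<^sup>-\<^sup>1 b \<triangleleft> c \<triangleleft>\<^sup>-\<^sup>1 d = x)
          \<longleftrightarrow> (\<forall>x\<in>carrier At. \<forall>(a, b, c, d)\<in>kernel_pair At fA \<box> kernel_pair At \<alpha>t.
            x \<triangleleft> a \<triangleleft>\<^sup>-\<^sup>1 d \<triangleleft> c \<triangleleft>\<^sup>-\<^sup>1 b = x))
       \<and> (double_covering At Ab Bt Bb fA fB \<alpha>t \<alpha>b
          \<longleftrightarrow> commutator At (kernel_pair At fA) (kernel_pair At \<alpha>t) = Id_on (carrier At))"
proof -
  let ?R = "kernel_pair At fA" and ?S = "kernel_pair At \<alpha>t"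
  have ext: "double_extension At Ab Bt Bb fA fB \<alpha>t \<alpha>b"
    using assms by (auto dest: quandle_double_extension.axioms)
  then interpret double_extension At Ab Bt Bb fA fB \<alpha>t \<alpha>b .
  have R: "rack_congruence At ?R"
    by (rule fA.A.rack_congruence_kernel_pair[OF fA.B.rack_axioms fA.hom])
  have S: "rack_congruence At ?S"
    by (rule fA.A.rack_congruence_kernel_pair[OF fB.A.rack_axioms top_hom])
  \<comment> \<open>In the bound tuple on the right-hand side \<open>b\<close> and \<open>d\<close> have changed places.\<close>
  have reflect: "(\<forall>x\<in>carrier At. \<forall>(a, b, c, d)\<in>?R \<box> ?S. P x a b c d)
      \<longleftrightarrow> (\<forall>x\<in>carrier At. \<forall>(a, d, c, b)\<in>?S \<box> ?R. P x a b c d)" for P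
    using square_transpose[of _ _ _ _ ?S ?R] by fastforce
  have ii: "squares_act_trivially At ?R ?S \<longleftrightarrow> (\<forall>x\<in>carrier At. \<forall>(a, b, c, d)\<in>?R \<box> ?S.
      x \<triangleleft>\<^sup>-\<^sup>1 a \<triangleleft> d \<triangleleft>\<^sup>-\<^sup>1 c \<triangleleft> b = x)"
    by (rule fA.A.squares_act_trivially_iff[OF R])
  have iii: "squares_act_trivially At ?R ?S \<longleftrightarrow> (\<forall>x\<in>carrier At. \<forall>(a, b, c, d)\<in>?R \<box> ?S.
      x \<triangleleft>\<^sup>-\<^sup>1 a \<triangleleft> b \<triangleleft>\<^sup>-\<^sup>1 c \<triangleleft> d = x)"
    unfolding fA.A.squares_act_trivially_commute[OF R S] reflect
    by (rule fA.A.squares_act_trivially_iff[OF S])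
  have iv: "squares_act_trivially At ?R ?S \<longleftrightarrow> (\<forall>x\<in>carrier At. \<forall>(a, b, c, d)\<in>?R \<box> ?S.
      x \<triangleleft> a \<triangleleft>\<^sup>-\<^sup>1 d \<triangleleft> c \<triangleleft>\<^sup>-\<^sup>1 b = x)"
    unfolding fA.A.squares_act_trivially_commute[OF R S] reflect
    by (rule squares_act_trivially_def)
  have "double_covering At Ab Bt Bb fA fB \<alpha>t \<alpha>b \<longleftrightarrow> squares_act_trivially At ?R ?S"
    unfolding double_covering_def squares_act_trivially_def using ext by simp
  then show ?thesis
    unfolding fA.A.commutator_eq_diagonal_iff squares_act_trivially_def[symmetric]
    using ii iii iv by blast
qed

end
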